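(* Let $R$ be a commutative ring with identity. (a) If $\mathrm{diam}(\Gamma(R))=0$, then $\mathrm{diam}(\mathbb{AG}(R))=0$. (b) If $\mathrm{diam}(\Gamma(R))=1$, then $\mathrm{diam}(\mathbb{AG}(R))=0$ or $1$. (c) If $\mathrm{diam}(\Gamma(R))=2$, then $\mathrm{diam}(\mathbb{AG}(R))=1$, $2$ or $3$. (d) If $\mathrm{diam}(\Gamma(R))=3$, then $\mathrm{diam}(\mathbb{AG}(R))=3$. (e) If $\mathrm{diam}(\mathbb{AG}(R))=0$, then $\mathrm{diam}(\Gamma(R))=0$ or $1$. (f) If $\mathrm{diam}(\mathbb{AG}(R))=1$, then $\mathrm{diam}(\Gamma(R))=1$ or $2$. (g) If $\mathrm{diam}(\mathbb{AG}(R))=2$, then $\mathrm{diam}(\Gamma(R))=2$. (h) If $\mathrm{diam}(\mathbb{AG}(R))=3$, then $\mathrm{diam}(\Gamma(R))=2$ or $3$.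
   Context: The zero divisor graph $\Gamma(R)$ is the simple graph whose vertices are the nonzero zero divisors of $R$, two distinct vertices $x,y$ being adjacent if and only if $xy=0$. An ideal $I$ of $R$ is an annihilating-ideal if $\mathrm{Ann}(I)\neq(0)$, i.e. there is a nonzero ideal $J$ of $R$ with $IJ=(0)$. The annihilating-ideal graph $\mathbb{AG}(R)$ is the undirected simple graph whose vertices are the nonzero annihilating-ideals of $R$, where two distinct vertices $I,J$ are adjacent if and only if $IJ=(0)$. For a graph $G$, $d(x,y)$ is the length of a shortest path from $x$ to $y$ ($\infty$ if there is none) and $\mathrm{diam}(G)=\sup\{d(x,y): x,y \text{ distinct vertices of } G\}$; $\mathrm{diam}(G)=0$ means that $G$ has exactly one vertex, and diameters are considered only for graphs with at least one vertex. *)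

theory Defs
  imports
    "HOL-Algebra.Ideal_Product"
    "HOL-Library.Extended_Nat"
    "Graph_Theory.Pair_Digraph"
begin

section \<open>Distance and diameter\<close>

text \<open>Undirected simple graphs are represented as symmetric loop-free pair digraphs
  (locale \<^locale>\<open>pair_bidirected_digraph\<close>). The graphs below may be infinite, so the
  locale \<^locale>\<open>pair_graph\<close>, which demands finiteness, does not apply.\<close>

text \<open>The infimum of the empty set is \<^term>\<open>\<infinity> :: enat\<close>, so vertices that are not joined
  by a path are at infinite distance.\<close>

definition graph_dist :: "'a pair_pre_digraph \<Rightarrow> 'a \<Rightarrow> 'a \<Rightarrow> enat" where
  "graph_dist G x y = (INF p \<in> {p. pre_digraph.apath (with_proj G) x p y}. enat (length p))"

definition graph_diam :: "'a pair_pre_digraph \<Rightarrow> enat" where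
  "graph_diam G =
     Sup {graph_dist G x y | x y. x \<in> pverts G \<and> y \<in> pverts G \<and> x \<noteq> y}"

text \<open>The supremum of the empty set in \<^typ>\<open>enat\<close> is \<open>0\<close>, so \<^const>\<open>graph_diam\<close> alone does not
  separate the null graph from the one-vertex graph. Diameters are considered only for graphs
  with at least one vertex; hence nonemptiness is part of the assertion that a graph has
  diameter \<open>d\<close>.\<close>

definition has_diam :: "'a pair_pre_digraph \<Rightarrow> enat \<Rightarrow> bool" where
  "has_diam G d \<longleftrightarrow> pverts G \<noteq> {} \<and> graph_diam G = d"

lemma has_diam_0_iff: "has_diam G 0 \<longleftrightarrow> (\<exists>v. pverts G = {v})"
proof
  assume G: "has_diam G 0"
  then obtain v where v: "v \<in> pverts G"
    unfolding has_diam_def by blast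
  have "x = v" if x: "x \<in> pverts G" for x
  proof (rule ccontr)
    assume ne: "x \<noteq> v"
    have "1 \<le> graph_dist G x v"
      unfolding graph_dist_def
    proof (rule INF_greatest)
      fix p assume "p \<in> {p. pre_digraph.apath (with_proj G) x p v}"
      then have "pcas x p v"
        unfolding pre_digraph.apath_def pre_digraph.awalk_def cas_with_proj_eq by blast
      with ne have "p \<noteq> []" by (cases p) simp_all
      then show "1 \<le> enat (length p)"
        by (cases p) (simp_all add: one_enat_def)
    qed
    also have "graph_dist G x v \<le> graph_diam G"
      unfolding graph_diam_def by (rule Sup_upper) (use x v ne in blast)
    finally show False
      using G unfolding has_diam_def by simp
  qed
  with v show "\<exists>v. pverts G = {v}" by blast
next
  assume "\<exists>v. pverts G = {v}"
  then obtain v where v: "pverts G = {v}" ..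
  then have "{graph_dist G x y | x y. x \<in> pverts G \<and> y \<in> pverts G \<and> x \<noteq> y} = {}"
    by simp
  with v show "has_diam G 0"
    unfolding has_diam_def graph_diam_def by (simp add: bot_enat_def)
qed


section \<open>The two graphs of a commutative ring\<close>

definition zero_divisors :: "('a, 'b) ring_scheme \<Rightarrow> 'a set" where
  "zero_divisors R =
     {x \<in> carrier R. \<exists>y \<in> carrier R. y \<noteq> \<zero>\<^bsub>R\<^esub> \<and> x \<otimes>\<^bsub>R\<^esub> y = \<zero>\<^bsub>R\<^esub>}"

definition zero_divisor_graph :: "('a, 'b) ring_scheme \<Rightarrow> 'a pair_pre_digraph" where
  "zero_divisor_graph R =
     (let V = zero_divisors R - {\<zero>\<^bsub>R\<^esub>}
      in \<lparr> pverts = V,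
           parcs = {(x, y). x \<in> V \<and> y \<in> V \<and> x \<noteq> y \<and> x \<otimes>\<^bsub>R\<^esub> y = \<zero>\<^bsub>R\<^esub>} \<rparr>)"

definition annihilator :: "('a, 'b) ring_scheme \<Rightarrow> 'a set \<Rightarrow> 'a set" where
  "annihilator R I = {r \<in> carrier R. \<forall>x \<in> I. r \<otimes>\<^bsub>R\<^esub> x = \<zero>\<^bsub>R\<^esub>}"

definition annihilating_ideal :: "'a set \<Rightarrow> ('a, 'b) ring_scheme \<Rightarrow> bool" where
  "annihilating_ideal I R \<longleftrightarrow> ideal I R \<and> annihilator R I \<noteq> {\<zero>\<^bsub>R\<^esub>}"

definition annihilating_ideal_graph :: "('a, 'b) ring_scheme \<Rightarrow> 'a set pair_pre_digraph" where
  "annihilating_ideal_graph R =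
     (let V = {I. annihilating_ideal I R} - {{\<zero>\<^bsub>R\<^esub>}}
      in \<lparr> pverts = V,
           parcs = {(I, J). I \<in> V \<and> J \<in> V \<and> I \<noteq> J \<and> ideal_prod R I J = {\<zero>\<^bsub>R\<^esub>}} \<rparr>)"

lemma (in cring) annihilating_ideal_iff:
  "annihilating_ideal I R \<longleftrightarrow>
     ideal I R \<and> (\<exists>J. ideal J R \<and> J \<noteq> {\<zero>} \<and> ideal_prod R I J = {\<zero>})"
proof (cases "ideal I R")
  case I: True
  then interpret I: ideal I R .
  have Ann: "ideal (annihilator R I) R"
  proof (rule idealI)
    show "subgroup (annihilator R I) (add_monoid R)"
      by (rule add.subgroupI)
        (auto simp: annihilator_def l_distr I.Icarr l_minus simp flip: a_inv_def)
  qed (auto simp: annihilator_def m_assoc I.Icarr I.I_l_closed ring_axioms)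
  have prod: "ideal_prod R I J = {\<zero>} \<longleftrightarrow> J \<subseteq> annihilator R I" if J: "ideal J R" for J
  proof -
    interpret J: ideal J R by (rule J)
    show ?thesis
    proof
      assume IJ: "ideal_prod R I J = {\<zero>}"
      show "J \<subseteq> annihilator R I"
      proof
        fix j assume j: "j \<in> J"
        have "i \<otimes> j = \<zero>" if "i \<in> I" for i
          using ideal_prod.prod[OF that j, of R] IJ by simp
        with j show "j \<in> annihilator R I"
          by (auto simp: annihilator_def J.Icarr I.Icarr m_comm)
      qed
    next
      assume sub: "J \<subseteq> annihilator R I"
      have "s = \<zero>" if "s \<in> ideal_prod R I J" for s
        using that
      proof induct
        case (prod i j)
        with sub have "j \<otimes> i = \<zero>" by (auto simp: annihilator_def)
        with prod show ?case by (simp add: m_comm I.Icarr J.Icarr)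
      qed auto
      moreover have "\<zero> \<in> ideal_prod R I J"
        using ideal_prod.prod[of \<zero> I \<zero> J R] by simp
      ultimately show "ideal_prod R I J = {\<zero>}" by blast
    qed
  qed
  have "\<zero> \<in> J" if "ideal J R" for J
    using that by (simp add: additive_subgroup.zero_closed ideal.axioms(1))
  with I Ann prod show ?thesis
    unfolding annihilating_ideal_def by blast
qed (simp add: annihilating_ideal_def)

lemma pair_bidirected_digraphI:
  assumes "\<And>x y. (x, y) \<in> parcs G \<Longrightarrow> x \<in> pverts G"
    and "\<And>x y. (x, y) \<in> parcs G \<Longrightarrow> x \<noteq> y"
    and "\<And>x y. (x, y) \<in> parcs G \<Longrightarrow> (y, x) \<in> parcs G"
  shows "pair_bidirected_digraph G"
proof -
  have wf: "pair_wf_digraph G"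
  proof
    fix e assume e: "e \<in> parcs G"
    obtain x y where xy: "e = (x, y)" by (rule prod.exhaust)
    with e assms(1,3) show "fst e \<in> pverts G" "snd e \<in> pverts G" by simp_all blast
  qed
  have "pair_sym_digraph G"
    using wf assms(3)
    by (intro pair_sym_digraph.intro pair_sym_digraph_axioms.intro)
      (simp_all add: symmetric_def sym_def)
  moreover have "pair_loopfree_digraph G"
    using wf assms(2)
    by (intro pair_loopfree_digraph.intro pair_loopfree_digraph_axioms.intro) auto
  ultimately show ?thesis
    by (rule pair_bidirected_digraph.intro)
qed

lemma (in cring) zero_divisor_graph_simple:
  "pair_bidirected_digraph (zero_divisor_graph R)"
  by (rule pair_bidirected_digraphI)
    (auto simp: zero_divisor_graph_def zero_divisors_def Let_def m_comm)

lemma (in cring) annihilating_ideal_graph_simple: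
  "pair_bidirected_digraph (annihilating_ideal_graph R)"
proof (rule pair_bidirected_digraphI)
  fix I J assume IJ: "(I, J) \<in> parcs (annihilating_ideal_graph R)"
  then have "ideal_prod R I J = ideal_prod R J I"
    by (intro ideal_prod_commute)
      (simp_all add: annihilating_ideal_graph_def annihilating_ideal_def Let_def)
  with IJ show "(J, I) \<in> parcs (annihilating_ideal_graph R)"
    by (auto simp: annihilating_ideal_graph_def Let_def)
qed (simp_all add: annihilating_ideal_graph_def Let_def)

end

theory Submission
  imports Defs
begin

text \<open>Both graphs are instances of one construction: the vertices carry a symmetric
  orthogonality relation ``the product vanishes'', and distinct orthogonal vertices are joined.
  A vertex can be orthogonal to itself, but this causes no trouble for distances: two distinct
  vertices are at distance at most two if and only if they are orthogonal or some vertex,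
  possibly one of the two, is orthogonal to both. Hence diameters up to two are described by the
  annihilation relation alone. The diameter never exceeds three: if \<open>x\<close> is killed
  by \<open>a\<close> and \<open>y\<close> by \<open>b\<close>, then either \<open>a b = 0\<close> and \<open>x - a - b - y\<close> is a walk, or a nonzero
  element \<open>a b\<close> (for ideals, a nonzero intersection) kills both \<open>x\<close> and \<open>y\<close>.

  So for a ring that has nonzero zero divisors, both diameters lie between zero and three, and
  everything follows from four comparisons: \<open>zero_divisor_diam_0_imp\<close>,
  \<open>zero_divisor_diam_le_1_imp\<close>, \<open>annihilating_ideal_diam_le_2_imp\<close> and
  \<open>annihilating_ideal_diam_0_imp\<close>. Passing from elements to ideals uses that every nonzero element
  of an annihilating ideal is a zero divisor. Passing back uses that the principal ideal of a zero
  divisor is an annihilating ideal, which is orthogonal to exactly those ideals that the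
  generator annihilates.\<close>

section \<open>Graphs of orthogonality relations\<close>

definition orth_graph :: "'v set \<Rightarrow> ('v \<Rightarrow> 'v \<Rightarrow> bool) \<Rightarrow> 'v pair_pre_digraph" where
  "orth_graph V r =
     \<lparr> pverts = V, parcs = {(x, y). x \<in> V \<and> y \<in> V \<and> x \<noteq> y \<and> r x y} \<rparr>"

lemma pverts_orth_graph [simp]: "pverts (orth_graph V r) = V"
  by (simp add: orth_graph_def)

lemma apath_orth_graph_iff:
  "pre_digraph.apath (with_proj (orth_graph V r)) x p y \<longleftrightarrow>
     x \<in> V \<and> set p \<subseteq> {(u, v). u \<in> V \<and> v \<in> V \<and> u \<noteq> v \<and> r u v} \<and> pcas x p y \<and>
     distinct (pawalk_verts x p)"
  unfolding pre_digraph.apath_def pre_digraph.awalk_def cas_with_proj_eq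
    awalk_verts_with_proj_eq
  by (simp add: orth_graph_def)

lemma graph_dist_le_length:
  assumes "pre_digraph.apath (with_proj G) x p y"
  shows "graph_dist G x y \<le> enat (length p)"
  unfolding graph_dist_def using assms by (intro INF_lower) simp

text \<open>An infimum of a nonempty set of extended naturals is attained.\<close>

lemma graph_dist_le_enatE:
  assumes "graph_dist G x y \<le> enat n"
  obtains p where "pre_digraph.apath (with_proj G) x p y" "length p \<le> n"
proof -
  have "\<exists>p. pre_digraph.apath (with_proj G) x p y \<and> length p \<le> n"
  proof (rule ccontr)
    assume none: "\<not> ?thesis"
    have "enat (Suc n) \<le> graph_dist G x y"
      unfolding graph_dist_def using none by (intro INF_greatest) (auto simp: not_le)
    with assms have "enat (Suc n) \<le> enat n"
      by (rule order_trans[rotated])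
    then show False by simp
  qed
  with that show thesis by blast
qed

lemma graph_diam_le_iff:
  "graph_diam G \<le> d \<longleftrightarrow>
     (\<forall>x\<in>pverts G. \<forall>y\<in>pverts G. x \<noteq> y \<longrightarrow> graph_dist G x y \<le> d)"
  unfolding graph_diam_def by (auto simp: Sup_le_iff)

lemma orth_graph_dist_le_1:
  assumes "x \<in> V" "y \<in> V" "x \<noteq> y" "r x y"
  shows "graph_dist (orth_graph V r) x y \<le> 1"
  using graph_dist_le_length[of "orth_graph V r" x "[(x, y)]" y] assms
  by (simp add: apath_orth_graph_iff one_enat_def)

text \<open>A common annihilator need not differ from \<open>x\<close> and \<open>y\<close>: if it coincides with one of
  them, then \<open>x\<close> and \<open>y\<close> are orthogonal and hence adjacent.\<close>

lemma orth_graph_dist_le_2: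
  assumes "x \<in> V" "y \<in> V" "x \<noteq> y" "z \<in> V" "r x z" "r z y"
  shows "graph_dist (orth_graph V r) x y \<le> 2"
proof (cases "z = x \<or> z = y")
  case True
  with assms have "graph_dist (orth_graph V r) x y \<le> 1"
    by (intro orth_graph_dist_le_1) auto
  then show ?thesis
    by (rule order_trans) simp
next
  case False
  with graph_dist_le_length[of "orth_graph V r" x "[(x, z), (z, y)]" y] assms
  show ?thesis
    by (auto simp: apath_orth_graph_iff numeral_eq_enat numeral_2_eq_2)
qed

text \<open>The walk \<open>x - a - b - y\<close> may repeat a vertex, and then \<open>a\<close> or \<open>b\<close> is a common annihilator
  of \<open>x\<close> and \<open>y\<close>, or \<open>x\<close> and \<open>y\<close> are orthogonal themselves.\<close>

lemma orth_graph_dist_le_3: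
  assumes "x \<in> V" "y \<in> V" "x \<noteq> y" "a \<in> V" "b \<in> V" "r x a" "r a b" "r b y"
  shows "graph_dist (orth_graph V r) x y \<le> 3"
proof -
  consider "r x y" | "r x b" | "r a y" | "x \<noteq> a" "x \<noteq> b" "a \<noteq> b" "a \<noteq> y" "b \<noteq> y"
    using assms by metis
  then show ?thesis
  proof cases
    case 1
    with assms have "graph_dist (orth_graph V r) x y \<le> 1"
      by (intro orth_graph_dist_le_1)
    then show ?thesis by (rule order_trans) simp
  next
    case 2
    with assms have "graph_dist (orth_graph V r) x y \<le> 2"
      by (intro orth_graph_dist_le_2[where z = b])
    then show ?thesis by (rule order_trans) simp
  next
    case 3
    with assms have "graph_dist (orth_graph V r) x y \<le> 2"
      by (intro orth_graph_dist_le_2[where z = a])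
    then show ?thesis by (rule order_trans) simp
  next
    case 4
    with graph_dist_le_length[of "orth_graph V r" x "[(x, a), (a, b), (b, y)]" y] assms
    show ?thesis
      by (auto simp: apath_orth_graph_iff numeral_eq_enat numeral_3_eq_3)
  qed
qed

lemma orth_graph_diam_le_1_iff:
  "graph_diam (orth_graph V r) \<le> 1 \<longleftrightarrow> (\<forall>x\<in>V. \<forall>y\<in>V. x \<noteq> y \<longrightarrow> r x y)"
proof -
  have "r x y" if "x \<noteq> y" and d: "graph_dist (orth_graph V r) x y \<le> 1" for x y
  proof -
    from d have "graph_dist (orth_graph V r) x y \<le> enat 1"
      by (simp add: one_enat_def)
    then obtain p where p: "pre_digraph.apath (with_proj (orth_graph V r)) x p y"
        "length p \<le> 1"
      by (rule graph_dist_le_enatE)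
    with \<open>x \<noteq> y\<close> obtain e where "p = [e]"
      by (cases p) (auto simp: apath_orth_graph_iff)
    with p show ?thesis
      by (auto simp: apath_orth_graph_iff)
  qed
  then show ?thesis
    by (auto simp: graph_diam_le_iff intro: orth_graph_dist_le_1)
qed

lemma orth_graph_diam_le_2_iff:
  "graph_diam (orth_graph V r) \<le> 2 \<longleftrightarrow>
     (\<forall>x\<in>V. \<forall>y\<in>V. x \<noteq> y \<longrightarrow> r x y \<or> (\<exists>z\<in>V. r x z \<and> r z y))"
proof -
  have "r x y \<or> (\<exists>z\<in>V. r x z \<and> r z y)"
    if "x \<noteq> y" and d: "graph_dist (orth_graph V r) x y \<le> 2" for x y
  proof -
    from d have "graph_dist (orth_graph V r) x y \<le> enat 2"
      by (simp add: numeral_eq_enat)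
    then obtain p where p: "pre_digraph.apath (with_proj (orth_graph V r)) x p y"
        "length p \<le> 2"
      by (rule graph_dist_le_enatE)
    with \<open>x \<noteq> y\<close> consider e where "p = [e]" | e f where "p = [e, f]"
      by (cases p rule: remdups_adj.cases) (auto simp: apath_orth_graph_iff)
    then show ?thesis
      using p by cases (auto simp: apath_orth_graph_iff)
  qed
  moreover have "graph_dist (orth_graph V r) x y \<le> 2"
    if "x \<in> V" "y \<in> V" "x \<noteq> y" "r x y" for x y
    using orth_graph_dist_le_1[of x V y r, OF that] by (rule order_trans) simp
  ultimately show ?thesis
    unfolding graph_diam_le_iff pverts_orth_graph using orth_graph_dist_le_2 by metis
qed

text \<open>The hypothesis \<open>refine\<close> abstracts the product of two elements and the intersection of two
  ideals, each of which is annihilated by everything that annihilates one of its two arguments.\<close>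

lemma orth_graph_diam_le_3:
  assumes sym: "\<And>x y. x \<in> V \<Longrightarrow> y \<in> V \<Longrightarrow> r x y \<Longrightarrow> r y x"
    and annihilated: "\<And>x. x \<in> V \<Longrightarrow> \<exists>z\<in>V. r x z"
    and refine: "\<And>a b. a \<in> V \<Longrightarrow> b \<in> V \<Longrightarrow> \<not> r a b \<Longrightarrow>
                   \<exists>c\<in>V. \<forall>w\<in>V. r w a \<or> r w b \<longrightarrow> r w c"
  shows "graph_diam (orth_graph V r) \<le> 3"
proof -
  have "graph_dist (orth_graph V r) x y \<le> 3" if xy: "x \<in> V" "y \<in> V" "x \<noteq> y" for x y
  proof -
    obtain a b where a: "a \<in> V" "r x a" and b: "b \<in> V" "r y b"
      using annihilated xy by blast
    show ?thesis
    proof (cases "r a b")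
      case True
      with a b xy sym show ?thesis
        by (intro orth_graph_dist_le_3[where a = a and b = b]) auto
    next
      case False
      then obtain c where c: "c \<in> V" "r x c" "r y c"
        using refine[of a b] a b xy by blast
      with xy sym have "graph_dist (orth_graph V r) x y \<le> 2"
        by (intro orth_graph_dist_le_2[where z = c]) auto
      then show ?thesis by (rule order_trans) simp
    qed
  qed
  then show ?thesis by (simp add: graph_diam_le_iff)
qed


section \<open>Zero divisors and annihilating ideals\<close>

definition ideal_orth :: "('a, 'b) ring_scheme \<Rightarrow> 'a set \<Rightarrow> 'a set \<Rightarrow> bool" where
  "ideal_orth R I J \<longleftrightarrow> (\<forall>i\<in>I. \<forall>j\<in>J. i \<otimes>\<^bsub>R\<^esub> j = \<zero>\<^bsub>R\<^esub>)"

context cring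
begin

definition zero_divisor_verts :: "'a set" where
  "zero_divisor_verts = zero_divisors R - {\<zero>}"

definition annihilating_ideal_verts :: "'a set set" where
  "annihilating_ideal_verts = {I. annihilating_ideal I R} - {{\<zero>}}"

lemma zero_divisor_vert_carrier: "x \<in> zero_divisor_verts \<Longrightarrow> x \<in> carrier R"
  by (simp add: zero_divisor_verts_def zero_divisors_def)

lemma zero_divisor_vert_nonzero: "x \<in> zero_divisor_verts \<Longrightarrow> x \<noteq> \<zero>"
  by (simp add: zero_divisor_verts_def)

lemma annihilating_ideal_vert_ideal: "I \<in> annihilating_ideal_verts \<Longrightarrow> ideal I R"
  by (simp add: annihilating_ideal_verts_def annihilating_ideal_def)

lemma annihilating_ideal_vert_nonzero: "I \<in> annihilating_ideal_verts \<Longrightarrow> I \<noteq> {\<zero>}"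
  by (simp add: annihilating_ideal_verts_def)

lemma zero_divisor_graph_orth:
  "zero_divisor_graph R = orth_graph zero_divisor_verts (\<lambda>x y. x \<otimes> y = \<zero>)"
  by (simp add: zero_divisor_graph_def zero_divisor_verts_def orth_graph_def Let_def)

lemma zero_mem_ideal: "ideal I R \<Longrightarrow> \<zero> \<in> I"
  by (simp add: additive_subgroup.zero_closed ideal.axioms(1))

lemma nonzero_ideal_iff: "ideal I R \<Longrightarrow> I \<noteq> {\<zero>} \<longleftrightarrow> (\<exists>i\<in>I. i \<noteq> \<zero>)"
  using zero_mem_ideal by blast

lemma ideal_prod_zero_iff:
  assumes "ideal I R" "ideal J R"
  shows "ideal_prod R I J = {\<zero>} \<longleftrightarrow> ideal_orth R I J"
proof
  assume "ideal_prod R I J = {\<zero>}"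
  then show "ideal_orth R I J"
    using ideal_prod.prod[of _ I _ J R] by (fastforce simp: ideal_orth_def)
next
  assume orth: "ideal_orth R I J"
  have "s = \<zero>" if "s \<in> ideal_prod R I J" for s
    using that orth by induct (auto simp: ideal_orth_def)
  moreover have "\<zero> \<in> ideal_prod R I J"
    using ideal_prod.prod[of \<zero> I \<zero> J R] assms by (simp add: zero_mem_ideal)
  ultimately show "ideal_prod R I J = {\<zero>}" by blast
qed

lemma ideal_orth_commute: "ideal I R \<Longrightarrow> ideal J R \<Longrightarrow> ideal_orth R I J \<longleftrightarrow> ideal_orth R J I"
proof -
  assume ideals: "ideal I R" "ideal J R"
  have "i \<otimes> j = j \<otimes> i" if "i \<in> I" "j \<in> J" for i j
    using that ideals by (intro m_comm) (simp_all add: ideal.Icarr)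
  then show ?thesis unfolding ideal_orth_def by force
qed

lemma annihilating_ideal_graph_orth:
  "annihilating_ideal_graph R = orth_graph annihilating_ideal_verts (ideal_orth R)"
proof -
  have "ideal_prod R I J = {\<zero>} \<longleftrightarrow> ideal_orth R I J"
    if "I \<in> annihilating_ideal_verts" "J \<in> annihilating_ideal_verts" for I J
    using that by (simp add: annihilating_ideal_vert_ideal ideal_prod_zero_iff)
  then have "{(I, J). I \<in> annihilating_ideal_verts \<and> J \<in> annihilating_ideal_verts \<and> I \<noteq> J \<and>
      ideal_prod R I J = {\<zero>}} = {(I, J). I \<in> annihilating_ideal_verts \<and>
      J \<in> annihilating_ideal_verts \<and> I \<noteq> J \<and> ideal_orth R I J}"
    by blast
  then show ?thesis
    by (simp add: annihilating_ideal_graph_def orth_graph_def Let_def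
        flip: annihilating_ideal_verts_def)
qed

lemma zero_divisor_vertI:
  assumes "x \<in> carrier R" "y \<in> carrier R" "x \<noteq> \<zero>" "y \<noteq> \<zero>" "x \<otimes> y = \<zero>"
  shows "x \<in> zero_divisor_verts"
  using assms by (auto simp: zero_divisor_verts_def zero_divisors_def)

lemma zero_divisor_vertE:
  assumes "x \<in> zero_divisor_verts"
  obtains y where "x \<in> carrier R" "x \<noteq> \<zero>" "y \<in> zero_divisor_verts" "x \<otimes> y = \<zero>"
proof -
  from assms obtain y where "x \<in> carrier R" "x \<noteq> \<zero>" "y \<in> carrier R" "y \<noteq> \<zero>" "x \<otimes> y = \<zero>"
    unfolding zero_divisor_verts_def zero_divisors_def by blast
  then show thesis
    using that zero_divisor_vertI[of y x] m_comm by metis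
qed

lemma annihilating_ideal_vertI:
  assumes "ideal I R" "ideal J R" "I \<noteq> {\<zero>}" "J \<noteq> {\<zero>}" "ideal_orth R I J"
  shows "I \<in> annihilating_ideal_verts"
proof -
  from assms have "ideal_prod R I J = {\<zero>}" by (simp add: ideal_prod_zero_iff)
  with assms have "annihilating_ideal I R" unfolding annihilating_ideal_iff by blast
  with assms(3) show ?thesis by (simp add: annihilating_ideal_verts_def)
qed

lemma annihilating_ideal_vertE:
  assumes "I \<in> annihilating_ideal_verts"
  obtains J where "ideal I R" "I \<noteq> {\<zero>}" "J \<in> annihilating_ideal_verts" "ideal_orth R I J"
proof -
  from assms obtain J where I: "ideal I R" "I \<noteq> {\<zero>}"
    and J: "ideal J R" "J \<noteq> {\<zero>}" "ideal_prod R I J = {\<zero>}"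
    unfolding annihilating_ideal_verts_def annihilating_ideal_iff by blast
  then have orth: "ideal_orth R I J" by (simp add: ideal_prod_zero_iff)
  with I J have "J \<in> annihilating_ideal_verts"
    by (intro annihilating_ideal_vertI[of J I]) (simp_all add: ideal_orth_commute)
  with I orth show thesis by (intro that)
qed

lemma mem_annihilating_ideal_vert:
  assumes "I \<in> annihilating_ideal_verts" "x \<in> I" "x \<noteq> \<zero>"
  shows "x \<in> zero_divisor_verts"
proof -
  from assms(1) obtain J where J: "ideal I R" "J \<in> annihilating_ideal_verts" "ideal_orth R I J"
    by (rule annihilating_ideal_vertE)
  then have "ideal J R" "J \<noteq> {\<zero>}"
    by (simp_all add: annihilating_ideal_vert_ideal annihilating_ideal_vert_nonzero)
  then obtain y where "y \<in> J" "y \<noteq> \<zero>" using nonzero_ideal_iff by blast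
  with assms J \<open>ideal J R\<close> show ?thesis
    by (intro zero_divisor_vertI[of x y]) (auto simp: ideal_orth_def ideal.Icarr)
qed

lemma ex_mem_annihilating_ideal_vert:
  assumes "I \<in> annihilating_ideal_verts"
  shows "\<exists>x\<in>I. x \<in> zero_divisor_verts"
proof -
  from assms have "ideal I R" "I \<noteq> {\<zero>}"
    by (simp_all add: annihilating_ideal_vert_ideal annihilating_ideal_vert_nonzero)
  then obtain x where "x \<in> I" "x \<noteq> \<zero>" by (auto simp: nonzero_ideal_iff)
  with mem_annihilating_ideal_vert[OF assms] show ?thesis by blast
qed

lemma principal_ideal_orth:
  assumes "x \<in> carrier R" "y \<in> carrier R" "x \<otimes> y = \<zero>"
  shows "ideal_orth R (PIdl x) (PIdl y)"
proof -
  have "(a \<otimes> x) \<otimes> (b \<otimes> y) = \<zero>" if ab: "a \<in> carrier R" "b \<in> carrier R" for a b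
  proof -
    have "(a \<otimes> x) \<otimes> (b \<otimes> y) = (a \<otimes> b) \<otimes> (x \<otimes> y)"
      using ab assms(1,2) by (simp add: m_ac)
    also have "\<dots> = \<zero>"
      using ab assms(3) by simp
    finally show ?thesis .
  qed
  then show ?thesis
    unfolding ideal_orth_def cgenideal_def by auto
qed

lemma principal_ideal_vert:
  assumes "x \<in> zero_divisor_verts"
  shows "PIdl x \<in> annihilating_ideal_verts"
proof -
  obtain y where x: "x \<in> carrier R" "x \<noteq> \<zero>" and y: "y \<in> zero_divisor_verts" "x \<otimes> y = \<zero>"
    using assms by (rule zero_divisor_vertE)
  then have y': "y \<in> carrier R" "y \<noteq> \<zero>"
    by (simp_all add: zero_divisor_vert_carrier zero_divisor_vert_nonzero)
  from x y' have "PIdl x \<noteq> {\<zero>}" "PIdl y \<noteq> {\<zero>}"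
    using cgenideal_self by blast+
  with x y y' show ?thesis
    by (intro annihilating_ideal_vertI[of "PIdl x" "PIdl y"])
      (auto simp: cgenideal_ideal principal_ideal_orth)
qed

lemma annihilating_ideal_verts_empty_iff:
  "annihilating_ideal_verts = {} \<longleftrightarrow> zero_divisor_verts = {}"
  using principal_ideal_vert ex_mem_annihilating_ideal_vert by blast

lemma zero_divisor_graph_diam_le_3: "graph_diam (zero_divisor_graph R) \<le> 3"
  unfolding zero_divisor_graph_orth
proof (rule orth_graph_diam_le_3)
  fix x y assume "x \<in> zero_divisor_verts" "y \<in> zero_divisor_verts" "x \<otimes> y = \<zero>"
  then show "y \<otimes> x = \<zero>" by (simp add: zero_divisor_vert_carrier m_comm)
next
  fix x assume "x \<in> zero_divisor_verts"
  then show "\<exists>z\<in>zero_divisor_verts. x \<otimes> z = \<zero>"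
    by (blast elim: zero_divisor_vertE)
next
  fix a b assume a: "a \<in> zero_divisor_verts" and b: "b \<in> zero_divisor_verts" and ab: "a \<otimes> b \<noteq> \<zero>"
  note carr = zero_divisor_vert_carrier
  have kills: "w \<otimes> (a \<otimes> b) = \<zero>"
    if w: "w \<in> zero_divisor_verts" and wab: "w \<otimes> a = \<zero> \<or> w \<otimes> b = \<zero>" for w
  proof -
    have "w \<otimes> (a \<otimes> b) = (w \<otimes> a) \<otimes> b" "w \<otimes> (a \<otimes> b) = a \<otimes> (w \<otimes> b)"
      using a b w by (simp_all add: carr m_ac)
    with a b wab carr show ?thesis by auto
  qed
  obtain d where d: "d \<in> zero_divisor_verts" "a \<otimes> d = \<zero>"
    using a by (rule zero_divisor_vertE)
  have "d \<otimes> (a \<otimes> b) = \<zero>"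
    using kills d a carr m_comm by metis
  with a b ab d have "a \<otimes> b \<in> zero_divisor_verts"
    by (intro zero_divisor_vertI[of "a \<otimes> b" d])
      (simp_all add: carr m_comm zero_divisor_vert_nonzero)
  with kills show "\<exists>c\<in>zero_divisor_verts.
      \<forall>w\<in>zero_divisor_verts. w \<otimes> a = \<zero> \<or> w \<otimes> b = \<zero> \<longrightarrow> w \<otimes> c = \<zero>"
    by blast
qed

lemma annihilating_ideal_graph_diam_le_3: "graph_diam (annihilating_ideal_graph R) \<le> 3"
  unfolding annihilating_ideal_graph_orth
proof (rule orth_graph_diam_le_3)
  fix I J assume "I \<in> annihilating_ideal_verts" "J \<in> annihilating_ideal_verts" "ideal_orth R I J"
  then show "ideal_orth R J I"
    by (simp add: annihilating_ideal_vert_ideal ideal_orth_commute)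
next
  fix I assume "I \<in> annihilating_ideal_verts"
  then show "\<exists>K\<in>annihilating_ideal_verts. ideal_orth R I K"
    by (blast elim: annihilating_ideal_vertE)
next
  fix I J assume I: "I \<in> annihilating_ideal_verts" and J: "J \<in> annihilating_ideal_verts"
    and IJ: "\<not> ideal_orth R I J"
  note ideals = annihilating_ideal_vert_ideal[OF I] annihilating_ideal_vert_ideal[OF J]
  obtain K where K: "K \<in> annihilating_ideal_verts" "ideal_orth R I K"
    using I by (rule annihilating_ideal_vertE)
  from IJ obtain i j where ij: "i \<in> I" "j \<in> J" "i \<otimes> j \<noteq> \<zero>"
    by (auto simp: ideal_orth_def)
  with ideals have "i \<otimes> j \<in> I \<inter> J"
    by (simp add: ideal.I_l_closed ideal.I_r_closed ideal.Icarr)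
  with ij have "I \<inter> J \<noteq> {\<zero>}" by blast
  moreover have "ideal_orth R (I \<inter> J) K"
    using K(2) by (simp add: ideal_orth_def)
  ultimately have vert: "I \<inter> J \<in> annihilating_ideal_verts"
    using K(1) ideals annihilating_ideal_vert_ideal annihilating_ideal_vert_nonzero
    by (intro annihilating_ideal_vertI[of "I \<inter> J" K] i_intersect)
  have "ideal_orth R W (I \<inter> J)" if "ideal_orth R W I \<or> ideal_orth R W J" for W
    using that unfolding ideal_orth_def by blast
  with vert show "\<exists>C\<in>annihilating_ideal_verts. \<forall>W\<in>annihilating_ideal_verts.
      ideal_orth R W I \<or> ideal_orth R W J \<longrightarrow> ideal_orth R W C"
    by (intro bexI[of _ "I \<inter> J"] ballI impI)
qed


section \<open>Comparison of the diameters\<close>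

text \<open>If \<open>x\<close> is the only nonzero zero divisor, then every nonzero annihilating ideal is
  \<open>{\<zero>, x}\<close>.\<close>

lemma zero_divisor_diam_0_imp:
  assumes "has_diam (zero_divisor_graph R) 0"
  shows "has_diam (annihilating_ideal_graph R) 0"
proof -
  obtain x where x: "zero_divisor_verts = {x}"
    using assms unfolding has_diam_0_iff zero_divisor_graph_orth by auto
  have eq: "I = {\<zero>, x}" if I: "I \<in> annihilating_ideal_verts" for I
  proof -
    have "ideal I R" using I by (rule annihilating_ideal_vert_ideal)
    then have "\<zero> \<in> I" by (rule zero_mem_ideal)
    moreover have "I \<subseteq> {\<zero>, x}"
      using mem_annihilating_ideal_vert[OF I] x by blast
    moreover have "x \<in> I"
      using ex_mem_annihilating_ideal_vert[OF I] x by simp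
    ultimately show ?thesis by blast
  qed
  have "annihilating_ideal_verts \<noteq> {}"
    using x annihilating_ideal_verts_empty_iff by simp
  with eq have "annihilating_ideal_verts = {{\<zero>, x}}" by blast
  then show ?thesis
    unfolding has_diam_0_iff annihilating_ideal_graph_orth by auto
qed

text \<open>When distinct zero divisors always annihilate each other, the product of two different
  annihilating ideals can only fail to vanish at the square of a common element \<open>i\<close>. An element
  \<open>k\<close> that lies in just one of the two ideals excludes this: \<open>k\<close> and \<open>i \<oplus> k\<close> are
  nonzero zero divisors, both different from \<open>i\<close> if \<open>i\<close> is nonzero, so \<open>i\<close> annihilates both and
  hence also their difference \<open>i\<close>.\<close>

lemma square_zero_if_zero_divisors_orthogonal:
  assumes complete: "\<And>x y. x \<in> zero_divisor_verts \<Longrightarrow> y \<in> zero_divisor_verts \<Longrightarrow> x \<noteq> y \<Longrightarrow> x \<otimes> y = \<zero>"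
    and J: "J \<in> annihilating_ideal_verts" and I: "ideal I R"
    and i: "i \<in> I" "i \<in> J" and k: "k \<in> J" "k \<notin> I"
  shows "i \<otimes> i = \<zero>"
proof (cases "i = \<zero>")
  case False
  have J': "ideal J R" using J by (rule annihilating_ideal_vert_ideal)
  interpret I: ideal I R by (rule I)
  interpret J: ideal J R by (rule J')
  have carr: "i \<in> carrier R" "k \<in> carrier R" using i k by auto
  have k0: "k \<noteq> \<zero>" using k by auto
  have sum0: "i \<oplus> k \<noteq> \<zero>"
  proof
    assume "i \<oplus> k = \<zero>"
    then have "k = \<ominus> i" using carr by (metis add.m_comm minus_equality)
    with i k show False by simp
  qed
  have sum_i: "i \<oplus> k \<noteq> i" using carr k0 by simp
  have verts: "i \<in> zero_divisor_verts" "k \<in> zero_divisor_verts" "i \<oplus> k \<in> zero_divisor_verts"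
    using mem_annihilating_ideal_vert[OF J] i k False k0 sum0 by auto
  have "i \<otimes> k = \<zero>" using complete verts i k by blast
  moreover have "i \<otimes> (i \<oplus> k) = \<zero>" using complete verts sum_i by metis
  ultimately show ?thesis using carr by (simp add: r_distr)
qed simp

lemma zero_divisor_diam_le_1_imp:
  assumes "graph_diam (zero_divisor_graph R) \<le> 1"
  shows "graph_diam (annihilating_ideal_graph R) \<le> 1"
proof -
  have complete: "x \<otimes> y = \<zero>"
    if "x \<in> zero_divisor_verts" "y \<in> zero_divisor_verts" "x \<noteq> y" for x y
    using assms that unfolding zero_divisor_graph_orth orth_graph_diam_le_1_iff by blast
  have "ideal_orth R I J"
    if I: "I \<in> annihilating_ideal_verts" and J: "J \<in> annihilating_ideal_verts" and "I \<noteq> J" for I J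
    unfolding ideal_orth_def
  proof (intro ballI)
    note ideals = annihilating_ideal_vert_ideal[OF I] annihilating_ideal_vert_ideal[OF J]
    fix i j assume ij: "i \<in> I" "j \<in> J"
    then have carr: "i \<in> carrier R" "j \<in> carrier R"
      using ideals by (simp_all add: ideal.Icarr)
    consider "i = \<zero> \<or> j = \<zero>" | "i \<noteq> \<zero>" "j \<noteq> \<zero>" "i \<noteq> j" | "i = j" by blast
    then show "i \<otimes> j = \<zero>"
    proof cases
      case 1
      with carr show ?thesis by auto
    next
      case 2
      with ij mem_annihilating_ideal_vert[OF I] mem_annihilating_ideal_vert[OF J] show ?thesis
        by (intro complete) auto
    next
      case 3
      from \<open>I \<noteq> J\<close> consider k where "k \<in> J" "k \<notin> I" | k where "k \<in> I" "k \<notin> J" by blast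
      then have "i \<otimes> i = \<zero>"
      proof cases
        case 1
        with 3 ij show ?thesis
          by (intro square_zero_if_zero_divisors_orthogonal[OF complete J ideals(1)]) auto
      next
        case 2
        with 3 ij show ?thesis
          by (intro square_zero_if_zero_divisors_orthogonal[OF complete I ideals(2)]) auto
      qed
      with 3 show ?thesis by simp
    qed
  qed
  then show ?thesis
    unfolding annihilating_ideal_graph_orth orth_graph_diam_le_1_iff by blast
qed

text \<open>A common annihilator of the principal ideals of \<open>x\<close> and \<open>y\<close> contains a common annihilator of
  \<open>x\<close> and \<open>y\<close>. If these two ideals coincide, any annihilator of \<open>x\<close> also annihilates \<open>y\<close>.\<close>

lemma annihilating_ideal_diam_le_2_imp:
  assumes "graph_diam (annihilating_ideal_graph R) \<le> 2"
  shows "graph_diam (zero_divisor_graph R) \<le> 2"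
proof -
  have "x \<otimes> y = \<zero> \<or> (\<exists>z\<in>zero_divisor_verts. x \<otimes> z = \<zero> \<and> z \<otimes> y = \<zero>)"
    if x: "x \<in> zero_divisor_verts" and y: "y \<in> zero_divisor_verts" for x y
  proof -
    have self: "x \<in> PIdl x" "y \<in> PIdl y"
      using x y by (simp_all add: cgenideal_self zero_divisor_vert_carrier)
    note verts = principal_ideal_vert[OF x] principal_ideal_vert[OF y]
    have "\<exists>K\<in>annihilating_ideal_verts. ideal_orth R (PIdl x) K \<and> ideal_orth R K (PIdl y)"
      if "\<not> ideal_orth R (PIdl x) (PIdl y)"
    proof (cases "PIdl x = PIdl y")
      case True
      obtain K where "ideal (PIdl x) R" "K \<in> annihilating_ideal_verts" "ideal_orth R (PIdl x) K"
        using verts(1) by (rule annihilating_ideal_vertE)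
      moreover from this have "ideal_orth R K (PIdl y)"
        using True by (simp add: ideal_orth_commute annihilating_ideal_vert_ideal)
      ultimately show ?thesis by blast
    next
      case False
      with assms verts that show ?thesis
        unfolding annihilating_ideal_graph_orth orth_graph_diam_le_2_iff by blast
    qed
    then consider "ideal_orth R (PIdl x) (PIdl y)"
      | K where "K \<in> annihilating_ideal_verts" "ideal_orth R (PIdl x) K" "ideal_orth R K (PIdl y)"
      by blast
    then show ?thesis
    proof cases
      case 1
      with self show ?thesis by (simp add: ideal_orth_def)
    next
      case 2
      moreover obtain z where "z \<in> K" "z \<in> zero_divisor_verts"
        using ex_mem_annihilating_ideal_vert 2(1) by blast
      ultimately show ?thesis
        using self unfolding ideal_orth_def by blast
    qed
  qed
  then show ?thesis
    unfolding zero_divisor_graph_orth orth_graph_diam_le_2_iff by blast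
qed

text \<open>If \<open>I\<close> is the only nonzero annihilating ideal, then \<open>I\<close> annihilates itself, because some
  nonzero annihilating ideal annihilates it; and \<open>I\<close> is the principal ideal of every
  nonzero zero divisor. So the product of any two zero divisors vanishes.\<close>

lemma annihilating_ideal_diam_0_imp:
  assumes "has_diam (annihilating_ideal_graph R) 0"
  shows "graph_diam (zero_divisor_graph R) \<le> 1"
proof -
  obtain I where I: "annihilating_ideal_verts = {I}"
    using assms unfolding has_diam_0_iff annihilating_ideal_graph_orth by auto
  then have "I \<in> annihilating_ideal_verts" by simp
  then obtain J where J: "J \<in> annihilating_ideal_verts" "ideal_orth R I J"
    by (rule annihilating_ideal_vertE)
  from I J(1) have "J = I" by simp
  with J(2) have II: "ideal_orth R I I" by simp
  have "x \<in> I" if "x \<in> zero_divisor_verts" for x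
  proof -
    have "x \<in> PIdl x" using that by (simp add: cgenideal_self zero_divisor_vert_carrier)
    with principal_ideal_vert[OF that] I show ?thesis by simp
  qed
  with II show ?thesis
    unfolding zero_divisor_graph_orth orth_graph_diam_le_1_iff ideal_orth_def by blast
qed

end

theorem proposition1p1:
  fixes R :: "('a, 'b) ring_scheme"
  assumes "cring R"
  shows
    "(has_diam (zero_divisor_graph R) 0 \<longrightarrow> has_diam (annihilating_ideal_graph R) 0) \<and>
     (has_diam (zero_divisor_graph R) 1 \<longrightarrow>
        has_diam (annihilating_ideal_graph R) 0 \<or> has_diam (annihilating_ideal_graph R) 1) \<and>
     (has_diam (zero_divisor_graph R) 2 \<longrightarrow>
        has_diam (annihilating_ideal_graph R) 1 \<or> has_diam (annihilating_ideal_graph R) 2 \<or>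
        has_diam (annihilating_ideal_graph R) 3) \<and>
     (has_diam (zero_divisor_graph R) 3 \<longrightarrow> has_diam (annihilating_ideal_graph R) 3) \<and>
     (has_diam (annihilating_ideal_graph R) 0 \<longrightarrow>
        has_diam (zero_divisor_graph R) 0 \<or> has_diam (zero_divisor_graph R) 1) \<and>
     (has_diam (annihilating_ideal_graph R) 1 \<longrightarrow>
        has_diam (zero_divisor_graph R) 1 \<or> has_diam (zero_divisor_graph R) 2) \<and>
     (has_diam (annihilating_ideal_graph R) 2 \<longrightarrow> has_diam (zero_divisor_graph R) 2) \<and>
     (has_diam (annihilating_ideal_graph R) 3 \<longrightarrow>
        has_diam (zero_divisor_graph R) 2 \<or> has_diam (zero_divisor_graph R) 3)"
proof -
  interpret cring R by (rule assms)
  let ?Z = "zero_divisor_graph R" and ?A = "annihilating_ideal_graph R"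
  have "pverts ?Z = {} \<longleftrightarrow> pverts ?A = {}"
    using annihilating_ideal_verts_empty_iff
    by (simp add: zero_divisor_graph_orth annihilating_ideal_graph_orth)
  then consider "pverts ?Z = {}" "pverts ?A = {}" | "pverts ?Z \<noteq> {}" "pverts ?A \<noteq> {}"
    by blast
  then show ?thesis
  proof cases
    case 1
    then show ?thesis by (simp add: has_diam_def)
  next
    case 2
    obtain m where m: "graph_diam ?Z = enat m" "m \<le> 3"
      using zero_divisor_graph_diam_le_3 by (cases "graph_diam ?Z") (auto simp: numeral_eq_enat)
    obtain n where n: "graph_diam ?A = enat n" "n \<le> 3"
      using annihilating_ideal_graph_diam_le_3
      by (cases "graph_diam ?A") (auto simp: numeral_eq_enat)
    have Z: "has_diam ?Z 0 \<longleftrightarrow> m = 0" "has_diam ?Z 1 \<longleftrightarrow> m = 1"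
      "has_diam ?Z 2 \<longleftrightarrow> m = 2" "has_diam ?Z 3 \<longleftrightarrow> m = 3"
      using 2 m by (simp_all add: has_diam_def zero_enat_def one_enat_def numeral_eq_enat)
    have A: "has_diam ?A 0 \<longleftrightarrow> n = 0" "has_diam ?A 1 \<longleftrightarrow> n = 1"
      "has_diam ?A 2 \<longleftrightarrow> n = 2" "has_diam ?A 3 \<longleftrightarrow> n = 3"
      using 2 n by (simp_all add: has_diam_def zero_enat_def one_enat_def numeral_eq_enat)
    have "m = 0 \<Longrightarrow> n = 0"
      using zero_divisor_diam_0_imp Z A by simp
    moreover have "m \<le> 1 \<Longrightarrow> n \<le> 1"
      using zero_divisor_diam_le_1_imp m n by (simp add: one_enat_def)
    moreover have "n \<le> 2 \<Longrightarrow> m \<le> 2"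
      using annihilating_ideal_diam_le_2_imp m n by (simp add: numeral_eq_enat)
    moreover have "n = 0 \<Longrightarrow> m \<le> 1"
      using annihilating_ideal_diam_0_imp A m by (simp add: one_enat_def)
    ultimately show ?thesis
      unfolding Z A using m(2) n(2) by presburger
  qed
qed

end
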